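(* Let $k\ge 3$ and let $P\in\mathcal{P}_3(k)$ be a finite poset. If $P$ is a Helly poset, then $\gamma_{\mathrm{os}}(P)\le \mathrm{we}(\mathrm{MD}(P))$. In particular, if $P$ is a complete Helly poset, then $\gamma_{\mathrm{os}}(P)=\mathrm{we}(\mathrm{MD}(P))$.
   Context: For a poset $P=(X,\le)$, $\mathrm{Max}(P)$ and $\mathrm{Min}(P)$ are the sets of maximal and minimal elements, and $\mathrm{Mid}(P)=X\setminus(\mathrm{Max}(P)\cup\mathrm{Min}(P))$. The height of $P$ is the maximum size (number of elements) of a chain. $\mathcal{P}_3(k)$ denotes the family of posets of height $k$ in which every element is contained in a chain of size at least $3$. The comparability graph $\mathrm{Comp}(P)$ has vertex set $X$, with $x\neq y$ adjacent iff $x<y$ or $y<x$. A dominating set of a graph is a set $S$ of vertices such that every vertex not in $S$ has a neighbor in $S$. An order-sensitive dominating set of $P$ is a dominating set $D$ of $\mathrm{Comp}(P)$ such that for every $x\in\mathrm{Mid}(P)$, either $x\in D$ or there are $a,b\in D$ with $a<x<b$. $\gamma_{\mathrm{os}}(P)$ is the minimum size of an order-sensitive dominating set of $P$. For $x\in X$, $U_P(x)=\{y: y>x\}$ and $D_P(x)=\{y:y<x\}$. The middle graph $\mathrm{MD}(P)$ of $P\in\mathcal{P}_3(k)$ ($k\ge3$) is the graph with vertex set $\mathrm{Mid}(P)$ in which distinct $a,b$ are adjacent iff $U_P(a)\cap U_P(b)\neq\emptyset$ and $D_P(a)\cap D_P(b)\neq\emptyset$. A family of sets is intersecting if every pair of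 its members has non-empty intersection. A family $\mathcal{F}$ has the Helly property if $\bigcap\mathcal{F}'\ne\emptyset$ for every (non-empty) intersecting subfamily $\mathcal{F}'\subseteq\mathcal{F}$. A poset $P\in\mathcal{P}_3(k)$ ($k\ge 3$) is a Helly poset if both families $\{U_P(x):x\in\mathrm{Mid}(P)\}$ and $\{D_P(x):x\in\mathrm{Mid}(P)\}$ have the Helly property. A Helly poset $P$ is a complete Helly poset if for every $S\subseteq\mathrm{Mid}(P)$, the family $\{U_P(x):x\in S\}$ is intersecting if and only if the family $\{D_P(x):x\in S\}$ is intersecting. For a graph $G$, the weight of a non-empty clique $C$ is $\mathrm{we}(C)=1$ if $|C|=1$ and $\mathrm{we}(C)=2$ if $|C|\ge2$. A clique partition $\mathcal{C}=\{C_1,\dots,C_n\}$ of $G$ is a partition of $V(G)$ into non-empty cliques, of weight $\mathrm{we}(\mathcal{C})=\sum_i\mathrm{we}(C_i)$. The weighted clique partition number $\mathrm{we}(G)$ is the minimum weight of a clique partition of $G$. *)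

theory Defs
  imports Main "HOL-Library.Disjoint_Sets"
begin

text \<open>
  A poset is a carrier \<open>X\<close> together with a reflexive order relation \<open>r\<close> on it, given by
  \<open>partial_order_on X r\<close>; \<open>(x, y) \<in> r\<close> stands for \<open>x \<le> y\<close>.
\<close>

definition less_rel :: "'a rel \<Rightarrow> 'a \<Rightarrow> 'a \<Rightarrow> bool" where
  "less_rel r x y \<longleftrightarrow> (x, y) \<in> r \<and> x \<noteq> y"

definition max_elts :: "'a set \<Rightarrow> 'a rel \<Rightarrow> 'a set" where
  "max_elts X r = {x \<in> X. \<not> (\<exists>y\<in>X. less_rel r x y)}"

definition min_elts :: "'a set \<Rightarrow> 'a rel \<Rightarrow> 'a set" where
  "min_elts X r = {x \<in> X. \<not> (\<exists>y\<in>X. less_rel r y x)}"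

definition mid_elts :: "'a set \<Rightarrow> 'a rel \<Rightarrow> 'a set" where
  "mid_elts X r = X - (max_elts X r \<union> min_elts X r)"

definition up_set :: "'a set \<Rightarrow> 'a rel \<Rightarrow> 'a \<Rightarrow> 'a set" where
  "up_set X r x = {y \<in> X. less_rel r x y}"

definition down_set :: "'a set \<Rightarrow> 'a rel \<Rightarrow> 'a \<Rightarrow> 'a set" where
  "down_set X r x = {y \<in> X. less_rel r y x}"

definition chain_in :: "'a set \<Rightarrow> 'a rel \<Rightarrow> 'a set \<Rightarrow> bool" where
  "chain_in X r C \<longleftrightarrow> C \<subseteq> X \<and> C \<in> Chains r"

definition has_height :: "'a set \<Rightarrow> 'a rel \<Rightarrow> nat \<Rightarrow> bool" where
  "has_height X r k \<longleftrightarrow>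
     (\<exists>C. chain_in X r C \<and> finite C \<and> card C = k) \<and>
     (\<forall>C. chain_in X r C \<longrightarrow> finite C \<and> card C \<le> k)"

definition P3 :: "nat \<Rightarrow> 'a set \<Rightarrow> 'a rel \<Rightarrow> bool" where
  "P3 k X r \<longleftrightarrow>
     partial_order_on X r \<and> has_height X r k \<and>
     (\<forall>x\<in>X. \<exists>C. chain_in X r C \<and> x \<in> C \<and> 3 \<le> card C)"

text \<open>A simple graph is a pair of a vertex set and a set of edges, each edge being an
  unordered pair of distinct vertices.\<close>

type_synonym 'a sgraph = "'a set \<times> 'a set set"

definition verts :: "'a sgraph \<Rightarrow> 'a set" where
  "verts G = fst G"

definition adj :: "'a sgraph \<Rightarrow> 'a \<Rightarrow> 'a \<Rightarrow> bool" where
  "adj G x y \<longleftrightarrow> {x, y} \<in> snd G"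

definition comp_graph :: "'a set \<Rightarrow> 'a rel \<Rightarrow> 'a sgraph" where
  "comp_graph X r =
     (X, {{x, y} | x y. x \<in> X \<and> y \<in> X \<and> x \<noteq> y \<and> (less_rel r x y \<or> less_rel r y x)})"

definition middle_graph :: "'a set \<Rightarrow> 'a rel \<Rightarrow> 'a sgraph" where
  "middle_graph X r =
     (mid_elts X r,
      {{a, b} | a b. a \<in> mid_elts X r \<and> b \<in> mid_elts X r \<and> a \<noteq> b \<and>
         up_set X r a \<inter> up_set X r b \<noteq> {} \<and> down_set X r a \<inter> down_set X r b \<noteq> {}})"

definition dominating_set :: "'a sgraph \<Rightarrow> 'a set \<Rightarrow> bool" where
  "dominating_set G S \<longleftrightarrow>
     S \<subseteq> verts G \<and> (\<forall>v \<in> verts G - S. \<exists>s\<in>S. adj G v s)"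

definition os_dominating_set :: "'a set \<Rightarrow> 'a rel \<Rightarrow> 'a set \<Rightarrow> bool" where
  "os_dominating_set X r D \<longleftrightarrow>
     dominating_set (comp_graph X r) D \<and>
     (\<forall>x \<in> mid_elts X r. x \<in> D \<or> (\<exists>a\<in>D. \<exists>b\<in>D. less_rel r a x \<and> less_rel r x b))"

definition gamma_os :: "'a set \<Rightarrow> 'a rel \<Rightarrow> nat" where
  "gamma_os X r = (LEAST n. \<exists>D. os_dominating_set X r D \<and> finite D \<and> card D = n)"

definition clique :: "'a sgraph \<Rightarrow> 'a set \<Rightarrow> bool" where
  "clique G C \<longleftrightarrow> C \<subseteq> verts G \<and> (\<forall>x\<in>C. \<forall>y\<in>C. x \<noteq> y \<longrightarrow> adj G x y)"

definition clique_weight :: "'a set \<Rightarrow> nat" where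
  "clique_weight C = (if card C = 1 then 1 else 2)"

text \<open>Non-emptiness of the parts is a component of \<open>partition_on\<close>.\<close>

definition clique_partition :: "'a sgraph \<Rightarrow> 'a set set \<Rightarrow> bool" where
  "clique_partition G \<C> \<longleftrightarrow>
     partition_on (verts G) \<C> \<and> finite \<C> \<and> (\<forall>C\<in>\<C>. clique G C)"

definition partition_weight :: "'a set set \<Rightarrow> nat" where
  "partition_weight \<C> = (\<Sum>C\<in>\<C>. clique_weight C)"

definition weighted_clique_partition_number :: "'a sgraph \<Rightarrow> nat" where
  "weighted_clique_partition_number G =
     (LEAST n. \<exists>\<C>. clique_partition G \<C> \<and> partition_weight \<C> = n)"

text \<open>Pairs with equal components are included below; for the families used here this makes
  no difference, since up-sets and down-sets of elements of \<open>mid_elts X r\<close> are non-empty.\<close>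

definition intersecting :: "'a set set \<Rightarrow> bool" where
  "intersecting F \<longleftrightarrow> (\<forall>A\<in>F. \<forall>B\<in>F. A \<inter> B \<noteq> {})"

definition helly_property :: "'a set set \<Rightarrow> bool" where
  "helly_property F \<longleftrightarrow> (\<forall>F'. F' \<subseteq> F \<and> F' \<noteq> {} \<and> intersecting F' \<longrightarrow> \<Inter> F' \<noteq> {})"

definition helly_poset :: "nat \<Rightarrow> 'a set \<Rightarrow> 'a rel \<Rightarrow> bool" where
  "helly_poset k X r \<longleftrightarrow>
     3 \<le> k \<and> P3 k X r \<and>
     helly_property (up_set X r ` mid_elts X r) \<and>
     helly_property (down_set X r ` mid_elts X r)"

definition complete_helly_poset :: "nat \<Rightarrow> 'a set \<Rightarrow> 'a rel \<Rightarrow> bool" where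
  "complete_helly_poset k X r \<longleftrightarrow>
     helly_poset k X r \<and>
     (\<forall>S \<subseteq> mid_elts X r. intersecting (up_set X r ` S) \<longleftrightarrow> intersecting (down_set X r ` S))"

end

theory Submission
  imports Defs
begin

text \<open>
  For the upper bound, replace each part of a clique partition of the middle graph that has at
  least two elements by a common upper bound and a common lower bound of the part, which the
  Helly property provides.

  For the lower bound, take an order-sensitive dominating set \<open>D\<close>. A middle element \<open>a\<close> of \<open>D\<close>
  lying below some middle \<open>x\<close> not in \<open>D\<close> can be exchanged for an element below \<open>a\<close>: everything
  \<open>a\<close> used to bound from above is also bounded by the element of \<open>D\<close> above \<open>x\<close>. The dual
  exchange is possible as well, so eventually the middle elements outside \<open>D\<close> are bounded by
  minimal and by maximal elements of \<open>D\<close>. In a complete Helly poset the middle elements above a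
  given element form a clique, and so do those below it; hence one may cover the middle elements
  outside \<open>D\<close> by cliques coming from the smaller one of the two extreme parts of \<open>D\<close>, and the
  factor 2 of the weight is paid for by the larger one.
\<close>

section \<open>The strict order and its dual\<close>

lemma less_rel_trans:
  assumes "partial_order_on X r" "less_rel r x y" "less_rel r y z"
  shows "less_rel r x z"
  using assms unfolding less_rel_def partial_order_on_def preorder_on_def
  by (metis antisymD transD)

lemma less_rel_irrefl [simp]: "\<not> less_rel r x x"
  by (simp add: less_rel_def)

lemma less_rel_asym:
  assumes "partial_order_on X r" "less_rel r x y"
  shows "\<not> less_rel r y x"
  using less_rel_trans[OF assms, of x] by auto

text \<open>Reversing the order swaps maximal with minimal elements and fixes the middle. These
  lemmas let one-sided arguments, such as the exchange step, be reused for their duals.\<close>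

lemma less_rel_converse [simp]: "less_rel (r\<inverse>) x y \<longleftrightarrow> less_rel r y x"
  by (auto simp: less_rel_def)

lemma max_elts_converse [simp]: "max_elts X (r\<inverse>) = min_elts X r"
  by (simp add: max_elts_def min_elts_def)

lemma min_elts_converse [simp]: "min_elts X (r\<inverse>) = max_elts X r"
  by (simp add: max_elts_def min_elts_def)

lemma mid_elts_converse [simp]: "mid_elts X (r\<inverse>) = mid_elts X r"
  by (auto simp: mid_elts_def)

lemma chain_in_converse [simp]: "chain_in X (r\<inverse>) C \<longleftrightarrow> chain_in X r C"
  by (auto simp: chain_in_def Chains_def)

lemma P3_converse: "P3 k X r \<Longrightarrow> P3 k X (r\<inverse>)"
  by (simp add: P3_def has_height_def)

lemma mid_elts_iff:
  "x \<in> mid_elts X r \<longleftrightarrow> x \<in> X \<and> up_set X r x \<noteq> {} \<and> down_set X r x \<noteq> {}"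
  by (auto simp: mid_elts_def max_elts_def min_elts_def up_set_def down_set_def)

text \<open>A chain of size at least 3 through \<open>x\<close> contains two further elements, both
  below \<open>x\<close> by maximality. The larger of the two lies strictly between the other one
  and \<open>x\<close>, so it is a middle element.\<close>

lemma mid_below_max:
  assumes "P3 k X r" "x \<in> max_elts X r"
  shows "\<exists>z\<in>mid_elts X r. less_rel r z x"
proof -
  have x: "x \<in> X" "\<And>y. y \<in> X \<Longrightarrow> \<not> less_rel r x y"
    using assms(2) by (auto simp: max_elts_def)
  obtain C where C: "C \<subseteq> X" "C \<in> Chains r" "x \<in> C" "3 \<le> card C"
    using assms(1) x(1) by (auto simp: P3_def chain_in_def)
  then have "card (C - {x}) \<ge> 2"
    by simp
  then obtain S where "S \<subseteq> C - {x}" "card S = 2"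
    by (meson obtain_subset_with_card_n)
  then obtain y z where yz: "y \<in> C" "z \<in> C" "y \<noteq> x" "z \<noteq> x" "y \<noteq> z"
    by (auto simp: card_2_iff)
  have comparable: "less_rel r u v \<or> less_rel r v u" if "u \<in> C" "v \<in> C" "u \<noteq> v" for u v
    using C(2) that by (auto simp: Chains_def less_rel_def)
  have below: "less_rel r y x" "less_rel r z x"
    using comparable yz C x by blast+
  have "y \<in> mid_elts X r \<or> z \<in> mid_elts X r"
    using comparable[OF yz(1,2,5)] below yz C x
    by (auto simp: mid_elts_iff up_set_def down_set_def)
  then show ?thesis
    using below by blast
qed

text \<open>A minimal element of the finite non-empty down-set of \<open>x\<close> is minimal in all
  of \<open>X\<close>, since anything below it would lie in that down-set as well.\<close>

lemma min_below_mid: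
  assumes "partial_order_on X r" "finite X" "x \<in> mid_elts X r"
  shows "\<exists>c\<in>min_elts X r. less_rel r c x"
proof -
  note trans = less_rel_trans[OF assms(1)]
  have "asymp_on (down_set X r x) (less_rel r)"
    using less_rel_asym[OF assms(1)] by (intro asymp_onI)
  moreover have "transp_on (down_set X r x) (less_rel r)"
    by (intro transp_onI) (rule trans)
  moreover have "finite (down_set X r x)" "down_set X r x \<noteq> {}"
    using assms(2,3) by (auto simp: down_set_def mid_elts_iff)
  ultimately obtain c where c: "c \<in> down_set X r x"
    "\<And>y. \<lbrakk>y \<in> down_set X r x; y \<noteq> c\<rbrakk> \<Longrightarrow> \<not> less_rel r y c"
    using Finite_Set.bex_min_element[of "down_set X r x" "less_rel r"] by blast
  then have "\<not> less_rel r y c" if "y \<in> X" for y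
    using that trans[of y c x] by (cases "y = c") (auto simp: down_set_def)
  then show ?thesis
    using c(1) by (auto simp: min_elts_def down_set_def)
qed

section \<open>Order-sensitive domination\<close>

text \<open>The condition that order-sensitivity puts on the middle elements, separated from
  domination. It is self-dual, and in \<open>P3\<close> it already implies domination.\<close>

definition bounds_mid :: "'a set \<Rightarrow> 'a rel \<Rightarrow> 'a set \<Rightarrow> bool" where
  "bounds_mid X r D \<longleftrightarrow> D \<subseteq> X \<and>
     (\<forall>x \<in> mid_elts X r. x \<in> D \<or> (\<exists>a\<in>D. \<exists>b\<in>D. less_rel r a x \<and> less_rel r x b))"

lemma bounds_mid_converse: "bounds_mid X r D \<Longrightarrow> bounds_mid X (r\<inverse>) D"
  unfolding bounds_mid_def by (simp, blast)

lemma adj_comp_graph: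
  "adj (comp_graph X r) x y \<longleftrightarrow> x \<in> X \<and> y \<in> X \<and> (less_rel r x y \<or> less_rel r y x)"
  by (auto simp: adj_def comp_graph_def doubleton_eq_iff less_rel_def)

text \<open>A middle element \<open>z\<close> below \<open>x\<close> either belongs to
  \<open>D\<close> or has an element of \<open>D\<close> below it; by transitivity \<open>D\<close>
  meets the down-set of \<open>x\<close> in both cases.\<close>

lemma bounds_mid_dominates_max:
  assumes "P3 k X r" "bounds_mid X r D" "x \<in> max_elts X r"
  shows "\<exists>s\<in>D. less_rel r s x"
proof -
  obtain z where z: "z \<in> mid_elts X r" "less_rel r z x"
    using mid_below_max assms by metis
  moreover have "partial_order_on X r"
    using assms(1) by (simp add: P3_def)
  ultimately show ?thesis
    using assms(2) less_rel_trans unfolding bounds_mid_def by metis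
qed

text \<open>Domination comes for free: maximal elements are dominated from below, minimal ones
  dually from above, and a middle element outside \<open>D\<close> is adjacent to its
  bounds.\<close>

lemma os_dominating_set_iff:
  assumes "P3 k X r"
  shows "os_dominating_set X r D \<longleftrightarrow> bounds_mid X r D"
proof
  assume "os_dominating_set X r D"
  then show "bounds_mid X r D"
    by (simp add: os_dominating_set_def bounds_mid_def dominating_set_def verts_def comp_graph_def)
next
  assume D: "bounds_mid X r D"
  have max: "\<exists>s\<in>D. less_rel r s x" if "x \<in> max_elts X r" for x
    using bounds_mid_dominates_max[OF assms D that] .
  have min: "\<exists>s\<in>D. less_rel r x s" if "x \<in> min_elts X r" for x
    using bounds_mid_dominates_max[OF P3_converse[OF assms] bounds_mid_converse[OF D], of x] that
    by simp
  have "\<exists>s\<in>D. adj (comp_graph X r) x s" if "x \<in> X" "x \<notin> D" for x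
  proof -
    have "\<exists>s\<in>D. less_rel r x s \<or> less_rel r s x"
      using max min D that unfolding bounds_mid_def mid_elts_def by blast
    then show ?thesis
      using that D by (auto simp: adj_comp_graph bounds_mid_def)
  qed
  then show "os_dominating_set X r D"
    using D by (auto simp: os_dominating_set_def bounds_mid_def dominating_set_def verts_def
        comp_graph_def)
qed

text \<open>The exchange puts a minimal \<open>c\<close> below \<open>a\<close> in place of
  \<open>a\<close>. As a lower bound \<open>c\<close> serves wherever \<open>a\<close> did. The
  strict drop in the number of middle elements is the measure for the minimality argument that
  follows.\<close>

lemma exchange_lower:
  assumes po: "partial_order_on X r" and "finite X" and D: "bounds_mid X r D"
    and a: "a \<in> D" "a \<in> mid_elts X r"
    and x: "x \<in> mid_elts X r" "x \<notin> D" "less_rel r a x"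
  shows "\<exists>D'. finite D' \<and> bounds_mid X r D' \<and> card D' \<le> card D \<and>
           card (D' \<inter> mid_elts X r) < card (D \<inter> mid_elts X r)"
proof -
  note trans = less_rel_trans[OF po]
  have "finite D"
    using D \<open>finite X\<close> finite_subset by (auto simp: bounds_mid_def)
  obtain c where c: "c \<in> min_elts X r" "less_rel r c a" "c \<in> X"
    using min_below_mid[OF po \<open>finite X\<close> a(2)] by (auto simp: min_elts_def)
  obtain b where b: "b \<in> D" "less_rel r x b"
    using D x unfolding bounds_mid_def by blast
  have ab: "less_rel r a b" "a \<noteq> b"
    using trans[OF x(3) b(2)] by auto
  define D' where "D' = insert c (D - {a})"
  have "bounds_mid X r D'"
    unfolding bounds_mid_def
  proof (intro conjI ballI)
    show "D' \<subseteq> X"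
      using D c by (auto simp: D'_def bounds_mid_def)
    fix y assume y: "y \<in> mid_elts X r"
    show "y \<in> D' \<or> (\<exists>a\<in>D'. \<exists>b\<in>D'. less_rel r a y \<and> less_rel r y b)"
    proof (cases "y \<in> D")
      case True
      \<comment> \<open>The only element of \<open>D\<close> that may have been lost is
        \<open>a\<close>; it lies between \<open>c\<close> and \<open>b\<close>, and
        \<open>b\<close> survives because it differs from \<open>a\<close>.\<close>
      then show ?thesis
        using b ab c by (cases "y = a") (auto simp: D'_def)
    next
      case False
      then obtain u v where uv: "u \<in> D" "v \<in> D" "less_rel r u y" "less_rel r y v"
        using D y unfolding bounds_mid_def by blast
      have "\<exists>u\<in>D'. less_rel r u y"
        using uv trans[OF c(2), of y] by (cases "u = a") (auto simp: D'_def)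
      moreover have "\<exists>v\<in>D'. less_rel r y v"
      proof (cases "v = a")
        case True
        then have "less_rel r y b"
          using trans[OF _ ab(1)] uv by blast
        then show ?thesis
          using b ab by (auto simp: D'_def)
      qed (use uv in \<open>auto simp: D'_def\<close>)
      ultimately show ?thesis
        by blast
    qed
  qed
  \<comment> \<open>Only an inequality, since \<open>c\<close> may already belong to
    \<open>D\<close>.\<close>
  moreover have "card D' \<le> card D"
    using card_Suc_Diff1[OF \<open>finite D\<close> a(1)] \<open>finite D\<close> by (auto simp: D'_def card_insert_if)
  \<comment> \<open>The middle part loses \<open>a\<close> and gains nothing, because
    \<open>c\<close> is minimal.\<close>
  moreover have "D' \<inter> mid_elts X r \<subset> D \<inter> mid_elts X r"
    using c a by (auto simp: D'_def mid_elts_def less_rel_def)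
  then have "card (D' \<inter> mid_elts X r) < card (D \<inter> mid_elts X r)"
    using \<open>finite D\<close> by (simp add: psubset_card_mono)
  ultimately show ?thesis
    using \<open>finite D\<close> by (intro exI[of _ D']) (simp add: D'_def)
qed

text \<open>Among the bounding sets of size at most \<open>card D\<close>, let \<open>E\<close> have
  the fewest middle elements. A middle element of \<open>E\<close> comparable to a middle element
  outside \<open>E\<close> would permit an exchange, contradicting this choice.\<close>

lemma extreme_bounds:
  assumes po: "partial_order_on X r" and "finite X" and D: "bounds_mid X r D"
  obtains E where "finite E" "bounds_mid X r E" "card E \<le> card D"
    "\<And>x a. \<lbrakk>x \<in> mid_elts X r - E; a \<in> E; less_rel r a x \<or> less_rel r x a\<rbrakk>
       \<Longrightarrow> a \<notin> mid_elts X r"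
proof -
  let ?Q = "\<lambda>E. finite E \<and> bounds_mid X r E \<and> card E \<le> card D"
  have "?Q D"
    using assms finite_subset by (auto simp: bounds_mid_def)
  then obtain E where E: "?Q E"
    and least: "\<And>F. ?Q F \<Longrightarrow> card (E \<inter> mid_elts X r) \<le> card (F \<inter> mid_elts X r)"
    using ex_has_least_nat[of ?Q D "\<lambda>E. card (E \<inter> mid_elts X r)"] by blast
  have po': "partial_order_on X (r\<inverse>)"
    using po by simp
  have E': "bounds_mid X (r\<inverse>) E"
    using E bounds_mid_converse by blast
  have extreme: "a \<notin> mid_elts X r"
    if x: "x \<in> mid_elts X r - E" and a: "a \<in> E" and cmp: "less_rel r a x \<or> less_rel r x a" for x a
  proof
    assume mid: "a \<in> mid_elts X r"
    have "\<exists>F. finite F \<and> bounds_mid X r F \<and> card F \<le> card E \<and>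
            card (F \<inter> mid_elts X r) < card (E \<inter> mid_elts X r)"
      using cmp
    proof
      assume "less_rel r a x"
      then show ?thesis
        using exchange_lower[OF po assms(2) _ a mid, of x] E x by blast
    next
      assume "less_rel r x a"
      \<comment> \<open>In the reversed order \<open>a\<close> lies below \<open>x\<close>, so the
        same exchange applies, with the same measure.\<close>
      then have "\<exists>F. finite F \<and> bounds_mid X (r\<inverse>) F \<and> card F \<le> card E \<and>
            card (F \<inter> mid_elts X r) < card (E \<inter> mid_elts X r)"
        using exchange_lower[OF po' assms(2) E' a, of x] E x mid by simp
      then show ?thesis
        using bounds_mid_converse[of X "r\<inverse>"] by auto
    qed
    then show False
      using least E by (meson le_trans not_le)
  qed
  show ?thesis
    by (rule that[of E]) (use E extreme in simp_all)
qed

section \<open>Clique partitions of the middle graph\<close>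

lemma verts_middle_graph [simp]: "verts (middle_graph X r) = mid_elts X r"
  by (simp add: verts_def middle_graph_def)

lemma adj_middle_graph:
  "adj (middle_graph X r) a b \<longleftrightarrow>
     a \<in> mid_elts X r \<and> b \<in> mid_elts X r \<and> a \<noteq> b \<and>
     up_set X r a \<inter> up_set X r b \<noteq> {} \<and> down_set X r a \<inter> down_set X r b \<noteq> {}"
  by (auto simp: adj_def middle_graph_def doubleton_eq_iff)

lemma clique_subset: "clique G C \<Longrightarrow> B \<subseteq> C \<Longrightarrow> clique G B"
  unfolding clique_def by blast

text \<open>Induction on \<open>F\<close>, with \<open>W\<close> arbitrary: one clique
  \<open>B\<close> is peeled off, leaving \<open>W - B\<close> for the others. What no clique covers
  lies in \<open>S\<close> and is split into singletons of weight 1, while each clique costs at most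
  2.\<close>

lemma partition_of_clique_cover:
  assumes "finite F" "finite S" "S \<subseteq> verts G" "\<And>C. C \<in> F \<Longrightarrow> clique G C"
  shows "W \<subseteq> S \<union> \<Union>F \<Longrightarrow> \<exists>\<C>. partition_on W \<C> \<and> finite \<C> \<and> (\<forall>C\<in>\<C>. clique G C) \<and>
           partition_weight \<C> \<le> card S + 2 * card F"
  using assms(1,4)
proof (induction F arbitrary: W)
  case empty
  then have W: "W \<subseteq> S" "finite W"
    using assms(2) finite_subset by auto
  have "partition_on W ((\<lambda>x. {x}) ` W)"
    by (auto simp: partition_on_def disjoint_def)
  moreover have "partition_weight ((\<lambda>x. {x}) ` W) = card W"
    by (simp add: partition_weight_def clique_weight_def sum.reindex)
  moreover have "clique G {x}" if "x \<in> W" for x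
    using that W assms(3) by (auto simp: clique_def)
  ultimately show ?case
    using W assms(2) card_mono by (intro exI[of _ "(\<lambda>x. {x}) ` W"]) auto
next
  case (insert B F)
  have "W - B \<subseteq> S \<union> \<Union>F"
    using insert.prems(1) by auto
  then obtain \<C> where \<C>: "partition_on (W - B) \<C>" "finite \<C>" "\<forall>C\<in>\<C>. clique G C"
    "partition_weight \<C> \<le> card S + 2 * card F"
    using insert.IH insert.prems(2) by (metis insertCI)
  show ?case
  \<comment> \<open>Parts must be non-empty, so \<open>B\<close> contributes one only if it meets
    \<open>W\<close>.\<close>
  proof (cases "W \<inter> B = {}")
    case True
    then have "W - B = W"
      by auto
    then show ?thesis
      using \<C> insert.hyps by (intro exI[of _ \<C>]) auto
  next
    case False
    have "partition_on W (insert (W \<inter> B) \<C>)"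
    proof -
      have "disjnt (W \<inter> B) (\<Union>\<C>)"
        using partition_onD1[OF \<C>(1)] by (auto simp: disjnt_iff)
      moreover have "W - W \<inter> B = W - B"
        by auto
      ultimately show ?thesis
        using \<C>(1) False by (simp add: partition_on_insert)
    qed
    moreover have "partition_weight (insert (W \<inter> B) \<C>) \<le> 2 + partition_weight \<C>"
      using \<C>(2) by (cases "W \<inter> B \<in> \<C>")
        (auto simp: partition_weight_def clique_weight_def insert_absorb)
    moreover have "clique G (W \<inter> B)"
      using insert.prems(2) clique_subset by (metis insertI1 inf_le2)
    ultimately show ?thesis
      using \<C> insert.hyps by (intro exI[of _ "insert (W \<inter> B) \<C>"]) auto
  qed
qed

lemma intersecting_pair:
  "intersecting (f ` {x, y}) \<longleftrightarrow> f x \<noteq> {} \<and> f y \<noteq> {} \<and> f x \<inter> f y \<noteq> {}"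
  by (auto simp: intersecting_def)

text \<open>Completeness for the pair \<open>{x, y}\<close>. Since \<open>intersecting\<close> also
  compares a set with itself, the non-emptiness of up-sets and down-sets of middle elements enters
  here.\<close>

lemma complete_helly_up_iff_down:
  assumes "complete_helly_poset k X r" "x \<in> mid_elts X r" "y \<in> mid_elts X r"
  shows "up_set X r x \<inter> up_set X r y \<noteq> {} \<longleftrightarrow> down_set X r x \<inter> down_set X r y \<noteq> {}"
proof -
  have "intersecting (up_set X r ` {x, y}) \<longleftrightarrow> intersecting (down_set X r ` {x, y})"
    using assms unfolding complete_helly_poset_def by (simp del: image_insert)
  then show ?thesis
    using assms(2,3) unfolding intersecting_pair by (simp add: mid_elts_iff)
qed

text \<open>Two middle elements above \<open>a\<close> share the lower bound \<open>a\<close>;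
  completeness then supplies a common upper bound, so they are adjacent.\<close>

lemma clique_up_set:
  assumes "complete_helly_poset k X r" "a \<in> X"
  shows "clique (middle_graph X r) (up_set X r a \<inter> mid_elts X r)"
proof -
  have "down_set X r x \<inter> down_set X r y \<noteq> {}" if "x \<in> up_set X r a" "y \<in> up_set X r a" for x y
    using that assms(2) by (auto simp: up_set_def down_set_def)
  then show ?thesis
    using complete_helly_up_iff_down[OF assms(1)]
    unfolding clique_def adj_middle_graph verts_middle_graph by blast
qed

lemma clique_down_set:
  assumes "complete_helly_poset k X r" "a \<in> X"
  shows "clique (middle_graph X r) (down_set X r a \<inter> mid_elts X r)"
proof -
  have "up_set X r x \<inter> up_set X r y \<noteq> {}" if "x \<in> down_set X r a" "y \<in> down_set X r a" for x y
    using that assms(2) by (auto simp: up_set_def down_set_def)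
  then show ?thesis
    using complete_helly_up_iff_down[OF assms(1)]
    unfolding clique_def adj_middle_graph verts_middle_graph by blast
qed

text \<open>The bound counts indices in \<open>A\<close> rather than distinct cliques; coincidences
  among the \<open>f a\<close> only lower the weight.\<close>

lemma clique_partition_of_cover:
  assumes "finite X" "D \<subseteq> X" "A \<subseteq> X" "\<And>a. a \<in> A \<Longrightarrow> clique (middle_graph X r) (f a)"
    and "mid_elts X r \<subseteq> D \<union> \<Union>(f ` A)"
  shows "\<exists>\<C>. clique_partition (middle_graph X r) \<C> \<and>
           partition_weight \<C> \<le> card (D \<inter> mid_elts X r) + 2 * card A"
proof -
  have fin: "finite (D \<inter> mid_elts X r)" "finite (f ` A)" "finite A"
    using assms(1-3) finite_subset by blast+
  moreover have "mid_elts X r \<subseteq> (D \<inter> mid_elts X r) \<union> \<Union>(f ` A)"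
    using assms(5) by auto
  ultimately obtain \<C> where "clique_partition (middle_graph X r) \<C>"
    "partition_weight \<C> \<le> card (D \<inter> mid_elts X r) + 2 * card (f ` A)"
    using partition_of_clique_cover[of "f ` A" "D \<inter> mid_elts X r" "middle_graph X r"
        "mid_elts X r"] assms(4)
    by (auto simp: clique_partition_def)
  then show ?thesis
    using card_image_le[OF fin(3), of f] by force
qed

section \<open>The two inequalities\<close>

lemma clique_partition_of_bounds:
  assumes "complete_helly_poset k X r" "finite X" "bounds_mid X r D"
  shows "\<exists>\<C>. clique_partition (middle_graph X r) \<C> \<and> partition_weight \<C> \<le> card D"
proof -
  have po: "partial_order_on X r"
    using assms(1) by (simp add: complete_helly_poset_def helly_poset_def P3_def)
  obtain E where E: "finite E" "bounds_mid X r E" "card E \<le> card D"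
    and extreme: "\<And>x a. \<lbrakk>x \<in> mid_elts X r - E; a \<in> E; less_rel r a x \<or> less_rel r x a\<rbrakk>
       \<Longrightarrow> a \<notin> mid_elts X r"
    using extreme_bounds[OF po assms(2,3)] by metis
  have "E \<subseteq> X"
    using E(2) by (simp add: bounds_mid_def)
  \<comment> \<open>Removing the maximal elements makes \<open>A\<close> and \<open>B\<close>
    disjoint by definition, so that their sizes add up.\<close>
  define A where "A = E \<inter> (min_elts X r - max_elts X r)"
  define B where "B = E \<inter> max_elts X r"
  have AB: "A \<subseteq> X" "B \<subseteq> X" "finite A" "finite B"
    using \<open>E \<subseteq> X\<close> E(1) by (auto simp: A_def B_def)
  have bounded: "(\<exists>a\<in>A. x \<in> up_set X r a) \<and> (\<exists>b\<in>B. x \<in> down_set X r b)"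
    if x: "x \<in> mid_elts X r - E" for x
  proof -
    obtain a b where ab: "a \<in> E" "b \<in> E" "less_rel r a x" "less_rel r x b"
      using E(2) x unfolding bounds_mid_def by blast
    have "x \<in> X"
      using x by (simp add: mid_elts_def)
    moreover have "a \<notin> mid_elts X r" "b \<notin> mid_elts X r"
      using extreme[OF x] ab by blast+
    \<comment> \<open>Neither is a middle element. As \<open>x\<close> lies above \<open>a\<close>
      and below \<open>b\<close>, \<open>a\<close> is minimal but not maximal, and \<open>b\<close>
      is maximal.\<close>
    ultimately have "a \<in> A" "b \<in> B"
      using ab \<open>E \<subseteq> X\<close> by (auto simp: A_def B_def mid_elts_def max_elts_def min_elts_def)
    then show ?thesis
      using ab \<open>x \<in> X\<close> by (auto simp: up_set_def down_set_def)
  qed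
  have card: "card E = card (E \<inter> mid_elts X r) + card A + card B"
  proof -
    have "E = (E \<inter> mid_elts X r \<union> A) \<union> B"
      using \<open>E \<subseteq> X\<close> by (auto simp: A_def B_def mid_elts_def)
    moreover have "(E \<inter> mid_elts X r) \<inter> A = {}" "(E \<inter> mid_elts X r \<union> A) \<inter> B = {}"
      by (auto simp: A_def B_def mid_elts_def)
    ultimately show ?thesis
      using E(1) AB by (metis card_Un_disjoint finite_Int finite_Un)
  qed
  have "\<exists>\<C>. clique_partition (middle_graph X r) \<C> \<and>
          partition_weight \<C> \<le> card (E \<inter> mid_elts X r) + 2 * card A"
  proof (rule clique_partition_of_cover[OF assms(2) \<open>E \<subseteq> X\<close> AB(1)])
    show "clique (middle_graph X r) (up_set X r a \<inter> mid_elts X r)" if "a \<in> A" for a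
      using clique_up_set[OF assms(1)] that AB by blast
    show "mid_elts X r \<subseteq> E \<union> (\<Union>a\<in>A. up_set X r a \<inter> mid_elts X r)"
      using bounded by blast
  qed
  moreover have "\<exists>\<C>. clique_partition (middle_graph X r) \<C> \<and>
          partition_weight \<C> \<le> card (E \<inter> mid_elts X r) + 2 * card B"
  proof (rule clique_partition_of_cover[OF assms(2) \<open>E \<subseteq> X\<close> AB(2)])
    show "clique (middle_graph X r) (down_set X r b \<inter> mid_elts X r)" if "b \<in> B" for b
      using clique_down_set[OF assms(1)] that AB by blast
    show "mid_elts X r \<subseteq> E \<union> (\<Union>b\<in>B. down_set X r b \<inter> mid_elts X r)"
      using bounded by blast
  qed
  \<comment> \<open>Twice the smaller of \<open>card A\<close> and \<open>card B\<close> is at most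
    their sum.\<close>
  moreover have "card (E \<inter> mid_elts X r) + 2 * card A \<le> card D \<or>
      card (E \<inter> mid_elts X r) + 2 * card B \<le> card D"
    using card E(3) by linarith
  ultimately show ?thesis
    using le_trans by blast
qed

lemma helly_common_element:
  assumes "helly_property (f ` M)" "C \<subseteq> M" "C \<noteq> {}"
    and "\<And>x y. \<lbrakk>x \<in> C; y \<in> C\<rbrakk> \<Longrightarrow> f x \<inter> f y \<noteq> {}"
  shows "\<exists>u. \<forall>x\<in>C. u \<in> f x"
proof -
  have "f ` C \<subseteq> f ` M" "f ` C \<noteq> {}" "intersecting (f ` C)"
    using assms(2-4) by (auto simp: intersecting_def)
  then have "\<Inter>(f ` C) \<noteq> {}"
    using assms(1) by (simp add: helly_property_def)
  then show ?thesis
    by auto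
qed

text \<open>The weights match this construction: a singleton is its own bounding set of size 1, and
  any other clique needs at most a common lower bound \<open>d\<close> and a common upper bound
  \<open>u\<close>.\<close>

lemma bounds_of_clique:
  assumes "helly_poset k X r" "clique (middle_graph X r) C" "C \<noteq> {}"
  shows "\<exists>B. B \<subseteq> X \<and> finite B \<and> card B \<le> clique_weight C \<and>
           (\<forall>x\<in>C. x \<in> B \<or> (\<exists>a\<in>B. \<exists>b\<in>B. less_rel r a x \<and> less_rel r x b))"
proof (cases "card C = 1")
  case True
  then obtain x where "C = {x}"
    by (auto simp: card_1_singleton_iff)
  then show ?thesis
    using assms(2) by (intro exI[of _ C]) (auto simp: clique_def clique_weight_def mid_elts_def)
next
  case False
  have sub: "C \<subseteq> mid_elts X r"
    using assms(2) by (simp add: clique_def)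
  have meet: "up_set X r x \<inter> up_set X r y \<noteq> {} \<and> down_set X r x \<inter> down_set X r y \<noteq> {}"
    if "x \<in> C" "y \<in> C" for x y
  proof (cases "x = y")
    case True
    then show ?thesis
      using that sub by (auto simp: mid_elts_iff)
  next
    case False
    then show ?thesis
      using assms(2) that by (simp add: clique_def adj_middle_graph)
  qed
  have "helly_property (up_set X r ` mid_elts X r)" "helly_property (down_set X r ` mid_elts X r)"
    using assms(1) by (simp_all add: helly_poset_def)
  then obtain u d where ud: "\<forall>x\<in>C. u \<in> up_set X r x" "\<forall>x\<in>C. d \<in> down_set X r x"
    using helly_common_element[OF _ sub assms(3)] meet by metis
  then have "{d, u} \<subseteq> X"
    using assms(3) by (auto simp: up_set_def down_set_def)
  moreover have "card {d, u} \<le> clique_weight C"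
    using False by (simp add: clique_weight_def card_insert_if)
  ultimately show ?thesis
    using ud by (intro exI[of _ "{d, u}"]) (auto simp: up_set_def down_set_def)
qed

text \<open>The bounding sets of the parts are united; each part keeps its own bounds in the union,
  and the size of the union is at most the sum of the sizes.\<close>

lemma bounds_of_clique_partition:
  assumes "helly_poset k X r" "clique_partition (middle_graph X r) \<C>"
  shows "\<exists>D. finite D \<and> bounds_mid X r D \<and> card D \<le> partition_weight \<C>"
proof -
  have \<C>: "partition_on (mid_elts X r) \<C>" "finite \<C>" "\<And>C. C \<in> \<C> \<Longrightarrow> clique (middle_graph X r) C"
    using assms(2) by (auto simp: clique_partition_def)
  have "\<And>C. C \<in> \<C> \<Longrightarrow> C \<noteq> {}"
    using \<C>(1) by (auto simp: partition_on_def)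
  then have "\<forall>C\<in>\<C>. \<exists>B. B \<subseteq> X \<and> finite B \<and> card B \<le> clique_weight C \<and>
           (\<forall>x\<in>C. x \<in> B \<or> (\<exists>a\<in>B. \<exists>b\<in>B. less_rel r a x \<and> less_rel r x b))"
    using bounds_of_clique[OF assms(1)] \<C>(3) by simp
  then obtain f where f: "\<And>C. C \<in> \<C> \<Longrightarrow> f C \<subseteq> X \<and> finite (f C) \<and> card (f C) \<le> clique_weight C \<and>
      (\<forall>x\<in>C. x \<in> f C \<or> (\<exists>a\<in>f C. \<exists>b\<in>f C. less_rel r a x \<and> less_rel r x b))"
    unfolding bchoice_iff by auto
  have "mid_elts X r = \<Union>\<C>"
    using \<C>(1) by (simp add: partition_on_def)
  then have "bounds_mid X r (\<Union>(f ` \<C>))"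
    using f unfolding bounds_mid_def by (simp add: UN_subset_iff) blast
  moreover have "card (\<Union>(f ` \<C>)) \<le> partition_weight \<C>"
  proof -
    have "card (\<Union>(f ` \<C>)) \<le> (\<Sum>C\<in>\<C>. card (f C))"
      by (rule card_UN_le[OF \<C>(2)])
    also have "\<dots> \<le> partition_weight \<C>"
      unfolding partition_weight_def by (rule sum_mono) (use f in blast)
    finally show ?thesis .
  qed
  moreover have "finite (\<Union>(f ` \<C>))"
    using f \<C>(2) by blast
  ultimately show ?thesis
    by blast
qed

theorem theorem28:
  fixes X :: "'a set" and r :: "'a rel" and k :: nat
  assumes "3 \<le> k" and "P3 k X r" and "finite X"
  shows "(helly_poset k X r \<longrightarrow>
            gamma_os X r \<le> weighted_clique_partition_number (middle_graph X r)) \<and>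
         (complete_helly_poset k X r \<longrightarrow>
            gamma_os X r = weighted_clique_partition_number (middle_graph X r))"
proof -
  let ?G = "middle_graph X r"
  note os_iff = os_dominating_set_iff[OF assms(2)]
  have "\<exists>\<C>. clique_partition ?G \<C> \<and> partition_weight \<C> = weighted_clique_partition_number ?G"
  proof -
    have "\<exists>\<C>. clique_partition ?G \<C>"
      \<comment> \<open>With \<open>D\<close> taken to be \<open>X\<close> and no cliques, the cover
        lemma yields a partition; hence the least weight is attained.\<close>
      using clique_partition_of_cover[OF assms(3) subset_refl, of "{}" r "\<lambda>x. {x}"]
      by (auto simp: mid_elts_def)
    then show ?thesis
      unfolding weighted_clique_partition_number_def
      by (intro LeastI_ex[of "\<lambda>n. \<exists>\<C>. clique_partition ?G \<C> \<and> partition_weight \<C> = n"]) blast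
  qed
  then obtain \<C> where \<C>: "clique_partition ?G \<C>"
    "partition_weight \<C> = weighted_clique_partition_number ?G"
    by blast
  have "\<exists>D. os_dominating_set X r D \<and> finite D \<and> card D = gamma_os X r"
  proof -
    \<comment> \<open>The whole carrier witnesses that the minimum defining \<open>gamma_os\<close>
      is attained.\<close>
    have "os_dominating_set X r X"
      by (auto simp: os_iff bounds_mid_def mid_elts_def)
    then show ?thesis
      unfolding gamma_os_def using assms(3)
      by (intro LeastI_ex[of "\<lambda>n. \<exists>D. os_dominating_set X r D \<and> finite D \<and> card D = n"]) blast
  qed
  then obtain D where D: "bounds_mid X r D" "card D = gamma_os X r"
    by (auto simp: os_iff)
  have le: "gamma_os X r \<le> weighted_clique_partition_number ?G" if helly: "helly_poset k X r"
  proof -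
    obtain E where E: "finite E" "bounds_mid X r E" "card E \<le> partition_weight \<C>"
      using bounds_of_clique_partition[OF helly \<C>(1)] by blast
    have "gamma_os X r \<le> card E"
      unfolding gamma_os_def os_iff using E by (intro Least_le) blast
    then show ?thesis
      using E \<C> by simp
  qed
  have ge: "weighted_clique_partition_number ?G \<le> gamma_os X r"
    if complete: "complete_helly_poset k X r"
  proof -
    obtain \<D> where \<D>: "clique_partition ?G \<D>" "partition_weight \<D> \<le> card D"
      using clique_partition_of_bounds[OF complete assms(3) D(1)] by blast
    have "weighted_clique_partition_number ?G \<le> partition_weight \<D>"
      unfolding weighted_clique_partition_number_def using \<D> by (intro Least_le) blast
    then show ?thesis
      using \<D> D by simp
  qed
  show ?thesis
    using le ge by (auto simp: complete_helly_poset_def)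
qed

end
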